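(* Let $m,c\ge 1$ be integers and let $F(m,c)$ be the hardware graph consisting of an $m\times m$ array of $K_{c,c}$ cells (as defined in the context). Then the complete graph $K_{cm+1}$ is minor-embeddable in $F(m,c)$.
   Context: All graphs are finite, simple and undirected. Hardware graph $F(m,c)$: its vertices are $v_{a,b}^{d}$ with $1\le a,b\le m$ and $1\le d\le 2c$, where $(a,b)$ is the (row, column) position of a cell in an $m\times m$ grid and $d$ is the position inside the cell. Positions $1,\dots,c$ form the left half of the cell and positions $c+1,\dots,2c$ the right half. The edges are exactly the following. - Inside each cell $(a,b)$: $v_{a,b}^{d}v_{a,b}^{d'}$ for $1\le d\le c<d'\le 2c$, so the cell is a $K_{c,c}$. - Vertical couplings: $v_{a,b}^{d}v_{a+1,b}^{d}$ for $1\le a<m$, $1\le b\le m$, $1\le d\le c$. - Horizontal couplings: $v_{a,b}^{d}v_{a,b+1}^{d}$ for $1\le a\le m$, $1\le b<m$, $c+1\le d\le 2c$. Minor embedding: $P=(V_P,E_P)$ is minor-embeddable in $F=(V_F,E_F)$ (is a minor of $F$) if one can assign to each $v\in V_P$ the nonempty vertex set of a connected subtree $T_v$ of $F$, with these vertex sets pairwise disjoint, such that for every $(u,v)\in E_P$ there are $i_u\in T_u$, $i_v\in T_v$ with $(i_u,i_v)\in E_F$. *)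

theory Defs
  imports "Graph_Theory.Graph_Theory" "HOL-Library.Disjoint_Sets"
begin

text \<open>
  Finite simple undirected graphs are represented as in the library, by the locale \<^locale>\<open>graph\<close>:
  finite digraphs without loops and parallel arcs whose arc set is symmetric.
\<close>

subsection \<open>The hardware graph\<close>

text \<open>The vertex $v_{a,b}^{d}$ is the triple \<open>(a, b, d)\<close>.\<close>

definition hardware_verts :: "nat \<Rightarrow> nat \<Rightarrow> (nat \<times> nat \<times> nat) set" where
  "hardware_verts m c = {1..m} \<times> {1..m} \<times> {1..2 * c}"

definition cell_edges :: "nat \<Rightarrow> nat \<Rightarrow> (nat \<times> nat \<times> nat) rel" where
  "cell_edges m c = {((a, b, d), (a, b, d')) | a b d d'.
     1 \<le> a \<and> a \<le> m \<and> 1 \<le> b \<and> b \<le> m \<and> 1 \<le> d \<and> d \<le> c \<and> c < d' \<and> d' \<le> 2 * c}"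

definition vertical_edges :: "nat \<Rightarrow> nat \<Rightarrow> (nat \<times> nat \<times> nat) rel" where
  "vertical_edges m c = {((a, b, d), (a + 1, b, d)) | a b d.
     1 \<le> a \<and> a < m \<and> 1 \<le> b \<and> b \<le> m \<and> 1 \<le> d \<and> d \<le> c}"

definition horizontal_edges :: "nat \<Rightarrow> nat \<Rightarrow> (nat \<times> nat \<times> nat) rel" where
  "horizontal_edges m c = {((a, b, d), (a, b + 1, d)) | a b d.
     1 \<le> a \<and> a \<le> m \<and> 1 \<le> b \<and> b < m \<and> c + 1 \<le> d \<and> d \<le> 2 * c}"

definition hardware_edges :: "nat \<Rightarrow> nat \<Rightarrow> (nat \<times> nat \<times> nat) rel" where
  "hardware_edges m c = cell_edges m c \<union> vertical_edges m c \<union> horizontal_edges m c"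

definition hardware_graph :: "nat \<Rightarrow> nat \<Rightarrow> (nat \<times> nat \<times> nat) pair_pre_digraph" where
  "hardware_graph m c = \<lparr> pverts = hardware_verts m c,
     parcs = hardware_edges m c \<union> (hardware_edges m c)\<inverse> \<rparr>"

lemma pair_graph_hardware_graph: "pair_graph (hardware_graph m c)"
proof -
  have sub: "hardware_edges m c \<subseteq> hardware_verts m c \<times> hardware_verts m c"
    by (auto simp: hardware_edges_def cell_edges_def vertical_edges_def horizontal_edges_def
        hardware_verts_def)
  have fin: "finite (hardware_verts m c)"
    by (simp add: hardware_verts_def)
  have fin': "finite (hardware_edges m c)"
    by (rule finite_subset[OF sub]) (simp add: fin)
  have irr: "(u, u) \<notin> hardware_edges m c" for u
    by (auto simp: hardware_edges_def cell_edges_def vertical_edges_def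
        horizontal_edges_def)
  show ?thesis
  proof
    show "symmetric (with_proj (hardware_graph m c))"
      by (auto simp: symmetric_def hardware_graph_def sym_def)
  qed (use sub fin fin' irr in \<open>auto simp: hardware_graph_def\<close>)
qed

lemma graph_hardware_graph: "graph (with_proj (hardware_graph m c))"
  by (rule pair_graph.pair_graphD_graph[OF pair_graph_hardware_graph])


subsection \<open>Minor embeddings\<close>

text \<open>
  The library's \<^const>\<open>tree\<close> does not describe undirected trees: in a symmetric digraph an edge
  traversed back and forth is a \<^const>\<open>pre_digraph.cycle\<close> of length 2. As the arcs are symmetric
  and neither loops nor parallel arcs exist, the undirected cycles are those of length at least 3.
\<close>

definition undirected_tree :: "('a, 'b) pre_digraph \<Rightarrow> bool" where
  "undirected_tree T \<longleftrightarrow> graph T \<and> connected T \<and> \<not> (\<exists>p. pre_digraph.cycle T p \<and> 3 \<le> length p)"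

text \<open>\<open>\<phi> v\<close> is the vertex set of the subtree assigned to \<open>v\<close>.\<close>

definition minor_embedding ::
  "('a, 'b) pre_digraph \<Rightarrow> ('c, 'd) pre_digraph \<Rightarrow> ('a \<Rightarrow> 'c set) \<Rightarrow> bool" where
  "minor_embedding P F \<phi> \<longleftrightarrow>
     (\<forall>v \<in> verts P. \<phi> v \<noteq> {} \<and> (\<exists>T. subgraph T F \<and> undirected_tree T \<and> verts T = \<phi> v)) \<and>
     disjoint_family_on \<phi> (verts P) \<and>
     (\<forall>(u, v) \<in> arcs_ends P. \<exists>i \<in> \<phi> u. \<exists>j \<in> \<phi> v. (i, j) \<in> arcs_ends F)"

definition minor_embeddable :: "('a, 'b) pre_digraph \<Rightarrow> ('c, 'd) pre_digraph \<Rightarrow> bool" where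
  "minor_embeddable P F \<longleftrightarrow> (\<exists>\<phi>. minor_embedding P F \<phi>)"

end

(* The vertices with b \<ge> i in row i and those with a \<le> i in column i give, for each position k,
   an L-shaped path with its corner in the diagonal cell (i, i); the paths of (i, k) and (j, l) with
   i \<le> j meet in the cell (i, j). These c * m paths avoid the cells below the diagonal. The
   additional branch set consists of the vertical lines below the diagonal, joined by the horizontal
   line of position 2 * c in row m; for this, the path of (m, c) gives up its vertex (m, m, 2 * c). *)

theory Submission
  imports Defs
begin

text \<open>Turns the tree condition on a branch set into arithmetic on coordinates: descending
  \<open>rank\<close> forces every chain of parents to end at \<open>r\<close>. The rank need not be
  the distance to the root, only decrease along \<open>parent\<close>.\<close>

lemma parent_pointer_tree:
  fixes G :: "'a pair_pre_digraph" and rank :: "'a \<Rightarrow> nat"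
  assumes G: "pair_graph G" and S: "S \<subseteq> pverts G" and r: "r \<in> S"
    and parent: "\<And>x. x \<in> S \<Longrightarrow> x \<noteq> r \<Longrightarrow>
      parent x \<in> S \<and> rank (parent x) < rank x \<and> (x, parent x) \<in> parcs G"
  shows "\<exists>T. subgraph T (with_proj G) \<and> undirected_tree T \<and> verts T = S"
proof -
  interpret G: pair_graph G by (rule G)
  \<comment> \<open>\<open>A\<close> orients each tree edge towards the root; \<open>T\<close> keeps
    only these edges, in both directions, and not all arcs of \<open>G\<close> inside
    \<open>S\<close>.\<close>
  define A where "A = (\<lambda>x. (x, parent x)) ` (S - {r})"
  define T where "T = \<lparr>pverts = S, parcs = A \<union> A\<inverse>\<rparr>"
  have arc: "u \<in> S \<and> v \<in> S \<and> u \<noteq> v \<and> (u, v) \<in> parcs G"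
    if "(u, v) \<in> A" for u v
    using that parent unfolding A_def by fastforce
  have fin: "finite S" using S G.pair_finite_verts finite_subset by blast
  have "finite A" using fin by (simp add: A_def)
  have pgT: "pair_graph T"
  proof
    show "symmetric (with_proj T)"
      by (auto simp: symmetric_def T_def sym_def)
  qed (use fin \<open>finite A\<close> in \<open>auto simp: T_def dest: arc\<close>)
  interpret T: pair_graph T by (rule pgT)
  have sub: "subgraph (with_proj T) (with_proj G)"
    unfolding subgraph_def compatible_def
    using S G.wf_digraph T.wf_digraph by (auto simp: T_def dest: arc G.arcs_symmetric)
  have to_root: "x \<rightarrow>\<^sup>*\<^bsub>with_proj T\<^esub> r" if "x \<in> S" for x
    using that
  proof (induction "rank x" arbitrary: x rule: less_induct)
    case less
    show ?case
    proof (cases "x = r")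
      case True
      moreover have "r \<in> pverts T" using r by (simp add: T_def)
      ultimately show ?thesis using T.reachable_refl by simp
    next
      case False
      then have "(x, parent x) \<in> parcs T" using less.prems by (auto simp: T_def A_def)
      moreover have "parent x \<rightarrow>\<^sup>*\<^bsub>with_proj T\<^esub> r" using less parent False by blast
      ultimately show ?thesis using T.adj_reachable_trans by simp
    qed
  qed
  have conn: "connected (with_proj T)"
    unfolding connected_def
  proof (rule strongly_connectedI)
    fix u v assume "u \<in> verts (mk_symmetric T)" "v \<in> verts (mk_symmetric T)"
    then have u: "u \<rightarrow>\<^sup>*\<^bsub>with_proj T\<^esub> r" and v: "v \<rightarrow>\<^sup>*\<^bsub>with_proj T\<^esub> r"
      using to_root by (auto simp: T_def)
    have "r \<rightarrow>\<^sup>*\<^bsub>with_proj T\<^esub> v"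
      by (rule symmetric_reachable[OF T.pair_sym_arcs v])
    with u have "u \<rightarrow>\<^sup>*\<^bsub>with_proj T\<^esub> v" by (rule T.reachable_trans)
    then show "u \<rightarrow>\<^sup>*\<^bsub>with_proj (mk_symmetric T)\<^esub> v" by (rule T.reachable_mk_symmetricI)
  qed (use r in \<open>auto simp: T_def\<close>)
  \<comment> \<open>Both neighbours on a cycle of a vertex of maximal rank would be its parent.\<close>
  have "length p < 3" if cyc: "T.cycle p" for p
  proof (rule ccontr)
    assume "\<not> length p < 3"
    obtain u where u: "set p \<subseteq> parcs T" "pcas u p u" "distinct (tl (pawalk_verts u p))" "p \<noteq> []"
      using cyc unfolding T.cycle_def T.awalk_def by auto
    from T.awalk_verts_conv'[of u p u] u have heads: "distinct (map snd p)" by simp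
    obtain e where e: "e \<in> set p" "\<And>f. f \<in> set p \<Longrightarrow> rank (snd f) \<le> rank (snd e)"
    proof -
      have "Max ((rank \<circ> snd) ` set p) \<in> (rank \<circ> snd) ` set p" using u by (intro Max_in) auto
      then obtain e where "e \<in> set p" "rank (snd e) = Max ((rank \<circ> snd) ` set p)" by auto
      then show ?thesis using that by (metis (no_types, lifting) Max_ge comp_apply finite_imageI
            finite_set image_eqI)
    qed
    obtain y x where yx: "e = (y, x)" by fastforce
    obtain p1 p2 where p: "p = p1 @ (y, x) # p2" using e(1) yx by (meson split_list)
    have walks: "pcas u p1 y" "pcas x p2 u" using u(2) by (auto simp: p)
    \<comment> \<open>The cycle is rotated so that it starts right after the arc
      \<open>(y, x)\<close>, which closes it up.\<close>
    then have walk: "pcas x (p2 @ p1) y" using T.awlast_if_cas[OF walks(2)] by simp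
    \<comment> \<open>As the cycle has length at least 3, two arcs remain besides
      \<open>(y, x)\<close>; hence the arc leaving \<open>x\<close> is not the one entering
      \<open>y\<close>.\<close>
    obtain z q where q: "p2 @ p1 = (x, z) # q" "q \<noteq> []"
    proof (cases "p2 @ p1")
      case (Cons f q)
      then show ?thesis using that \<open>\<not> length p < 3\<close> walk p
        by (cases f; cases q) (auto simp: Cons_eq_append_conv append_eq_Cons_conv)
    qed (use \<open>\<not> length p < 3\<close> p in auto)
    have "snd (last q) = y"
      using walk q T.awlast_if_cas[OF walk] by (simp add: T.awalk_verts_conv)
    have "set p = insert (y, x) (set (p2 @ p1))" by (auto simp: p)
    then have inp: "(y, x) \<in> set p" "(x, z) \<in> set p" "last q \<in> set p" using q by auto
    \<comment> \<open>Otherwise \<open>x\<close> would be the parent of \<open>w\<close> and so have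
      smaller rank.\<close>
    have up: "w = parent x" if "(w, x) \<in> A \<union> A\<inverse>" "rank w \<le> rank x" for w
      using that parent by (auto simp: A_def dest: parent)
    have "rank y \<le> rank x" "rank z \<le> rank x"
      using e(2)[OF inp(3)] e(2)[OF inp(2)] \<open>snd (last q) = y\<close> yx by auto
    moreover have "(y, x) \<in> A \<union> A\<inverse>" "(z, x) \<in> A \<union> A\<inverse>"
      using inp u(1) by (auto simp: T_def)
    ultimately have "y = z" using up by metis
    \<comment> \<open>The first and the last of the remaining arcs are different but would have the
      common head \<open>y = z\<close>.\<close>
    moreover have "distinct (map snd (p2 @ p1))" using heads by (auto simp: p)
    ultimately show False using q \<open>snd (last q) = y\<close> by (auto simp: image_iff)
  qed
  then have "undirected_tree (with_proj T)"
    unfolding undirected_tree_def using conn T.pair_graphD_graph by fastforce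
  then show ?thesis using sub by (intro exI[of _ "with_proj T"]) (auto simp: T_def)
qed

text \<open>For \<open>i = m\<close> the horizontal arm is the single vertex
  \<open>(m, m, c + k)\<close>, so the exception for \<open>(m, c)\<close> removes just
  \<open>(m, m, 2 * c)\<close> and leaves a straight path.\<close>

definition bent_path :: "nat \<Rightarrow> nat \<Rightarrow> nat \<times> nat \<Rightarrow> (nat \<times> nat \<times> nat) set" where
  "bent_path m c = (\<lambda>(i, k). {(a, b, d).
     b = i \<and> d = k \<and> 1 \<le> a \<and> a \<le> i \<or>
     a = i \<and> d = c + k \<and> i \<le> b \<and> b \<le> m \<and> (i, k) \<noteq> (m, c)})"

text \<open>The tooth lines of column \<open>b\<close> occupy rows \<open>b + 1\<close> to
  \<open>m\<close>, so column \<open>m\<close> has none; for \<open>m = 1\<close> only the vertex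
  \<open>(1, 1, 2 * c)\<close> of the spine remains.\<close>

definition comb :: "nat \<Rightarrow> nat \<Rightarrow> (nat \<times> nat \<times> nat) set" where
  "comb m c = {(a, b, d).
     1 \<le> b \<and> b < a \<and> a \<le> m \<and> 1 \<le> d \<and> d \<le> c \<or>
     a = m \<and> d = 2 * c \<and> 1 \<le> b \<and> b \<le> m}"

lemma hardware_edges_iff:
  "((a, b, d), (a', b', d')) \<in> hardware_edges m c \<longleftrightarrow>
     a = a' \<and> b = b' \<and> 1 \<le> a \<and> a \<le> m \<and> 1 \<le> b \<and> b \<le> m \<and> 1 \<le> d \<and> d \<le> c \<and> c < d' \<and> d' \<le> 2 * c \<or>
     a' = a + 1 \<and> b = b' \<and> d = d' \<and> 1 \<le> a \<and> a < m \<and> 1 \<le> b \<and> b \<le> m \<and> 1 \<le> d \<and> d \<le> c \<or>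
     a = a' \<and> b' = b + 1 \<and> d = d' \<and> 1 \<le> a \<and> a \<le> m \<and> 1 \<le> b \<and> b < m \<and> c + 1 \<le> d \<and> d \<le> 2 * c"
  unfolding hardware_edges_def cell_edges_def vertical_edges_def horizontal_edges_def
  by blast

lemma arcs_hardware_iff:
  "(u, v) \<in> parcs (hardware_graph m c) \<longleftrightarrow>
     (u, v) \<in> hardware_edges m c \<or> (v, u) \<in> hardware_edges m c"
  by (simp add: hardware_graph_def)

lemma pverts_hardware: "pverts (hardware_graph m c) = {1..m} \<times> {1..m} \<times> {1..2 * c}"
  by (simp add: hardware_graph_def hardware_verts_def)

lemma bent_path_tree:
  assumes "i \<in> {1..m}" "k \<in> {1..c}"
  shows "\<exists>T. subgraph T (with_proj (hardware_graph m c)) \<and> undirected_tree T \<and>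
    verts T = bent_path m c (i, k)"
\<comment> \<open>The root is the left vertex of the corner, which the path of \<open>(m, c)\<close>
  keeps as well. The rank is the distance to it; the \<open>+ 1\<close> counts the cell edge that
  links the two arms.\<close>
proof (rule parent_pointer_tree[OF pair_graph_hardware_graph, where r = "(i, i, k)"
      and parent = "\<lambda>(a, b, d). if d \<le> c then (a + 1, b, d)
        else if b = i then (i, i, k) else (a, b - 1, d)"
      and rank = "\<lambda>(a, b, d). if d \<le> c then i - a else b - i + 1"])
  show "bent_path m c (i, k) \<subseteq> pverts (hardware_graph m c)"
    using assms by (auto simp: bent_path_def pverts_hardware)
  show "(i, i, k) \<in> bent_path m c (i, k)" using assms by (auto simp: bent_path_def)
qed (use assms in \<open>auto simp: bent_path_def arcs_hardware_iff hardware_edges_iff split: if_splits\<close>)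

lemma comb_tree:
  assumes "m \<ge> 1" "c \<ge> 1"
  shows "\<exists>T. subgraph T (with_proj (hardware_graph m c)) \<and> undirected_tree T \<and> verts T = comb m c"
\<comment> \<open>Teeth descend to row \<open>m\<close>, cross to the spine and follow it
  rightwards. Tooth vertices have rank at least \<open>m\<close>, spine vertices rank below
  \<open>m\<close>, so the crossing decreases the rank.\<close>
proof (rule parent_pointer_tree[OF pair_graph_hardware_graph, where r = "(m, m, 2 * c)"
      and parent = "\<lambda>(a, b, d). if d > c then (a, b + 1, d)
        else if a = m then (m, b, 2 * c) else (a + 1, b, d)"
      and rank = "\<lambda>(a, b, d). if d > c then m - b else m + m - a"])
  show "comb m c \<subseteq> pverts (hardware_graph m c)"
    using assms by (auto simp: comb_def pverts_hardware)
  show "(m, m, 2 * c) \<in> comb m c" using assms by (auto simp: comb_def)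
qed (use assms in \<open>auto simp: comb_def arcs_hardware_iff hardware_edges_iff split: if_splits\<close>)

text \<open>The index can be read off any vertex: it is \<open>(b, d)\<close> if
  \<open>d \<le> c\<close>, and \<open>(a, d - c)\<close> otherwise.\<close>

lemma bent_paths_disjoint:
  assumes "x \<in> {1..m} \<times> {1..c}" "y \<in> {1..m} \<times> {1..c}" "x \<noteq> y"
  shows "bent_path m c x \<inter> bent_path m c y = {}"
  using assms by (auto simp: bent_path_def)

lemma bent_path_comb_disjoint:
  assumes "x \<in> {1..m} \<times> {1..c}"
  shows "bent_path m c x \<inter> comb m c = {}"
  using assms by (auto simp: bent_path_def comb_def)

definition touching ::
  "nat \<Rightarrow> nat \<Rightarrow> (nat \<times> nat \<times> nat) set \<Rightarrow> (nat \<times> nat \<times> nat) set \<Rightarrow> bool" where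
  "touching m c X Y \<longleftrightarrow> (\<exists>i\<in>X. \<exists>j\<in>Y. (i, j) \<in> parcs (hardware_graph m c))"

lemma touching_sym:
  assumes "touching m c X Y"
  shows "touching m c Y X"
proof -
  interpret pair_graph "hardware_graph m c" by (rule pair_graph_hardware_graph)
  show ?thesis using assms arcs_symmetric unfolding touching_def by blast
qed

lemma bent_paths_touching:
  assumes "x \<in> {1..m} \<times> {1..c}" "y \<in> {1..m} \<times> {1..c}" "x \<noteq> y"
  shows "touching m c (bent_path m c x) (bent_path m c y)"
proof -
  \<comment> \<open>The first path contributes its horizontal arm and the second its vertical arm.
    Only \<open>(m, c)\<close> lacks a horizontal arm, so it must not come first.\<close>
  have *: "touching m c (bent_path m c (i, k)) (bent_path m c (j, l))"
    if "i \<le> j" "(i, k) \<noteq> (m, c)" "i \<in> {1..m}" "j \<in> {1..m}" "k \<in> {1..c}" "l \<in> {1..c}" for i j k l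
    unfolding touching_def
  proof (intro bexI)
    show "((i, j, c + k), (i, j, l)) \<in> parcs (hardware_graph m c)"
      using that by (auto simp: arcs_hardware_iff hardware_edges_iff)
  qed (use that in \<open>auto simp: bent_path_def\<close>)
  obtain i k j l where xy: "x = (i, k)" "y = (j, l)" by fastforce
  show ?thesis
  proof (cases "i \<le> j \<and> x \<noteq> (m, c)")
    case True
    then show ?thesis using * assms xy by auto
  next
    case False
    \<comment> \<open>Either \<open>j < i \<le> m\<close>, or \<open>x = (m, c)\<close> and
      \<open>y\<close> is a different index.\<close>
    then have "j \<le> i" "y \<noteq> (m, c)" using assms xy by auto
    then have "touching m c (bent_path m c y) (bent_path m c x)" using * assms xy by auto
    then show ?thesis by (rule touching_sym)
  qed
qed

lemma bent_path_comb_touching: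
  assumes "x \<in> {1..m} \<times> {1..c}"
  shows "touching m c (bent_path m c x) (comb m c)"
proof -
  obtain i k where x: "x = (i, k)" by fastforce
  show ?thesis
    unfolding touching_def
  proof (intro bexI)
    \<comment> \<open>From the corner, a vertical coupling leads down into the tooth of column
      \<open>i\<close>; in the last row a cell edge reaches the vertex given up by the path of
      \<open>(m, c)\<close>.\<close>
    show "((i, i, k), if i = m then (m, m, 2 * c) else (i + 1, i, k)) \<in> parcs (hardware_graph m c)"
      using assms x by (auto simp: arcs_hardware_iff hardware_edges_iff)
  qed (use assms x in \<open>auto simp: bent_path_def comb_def\<close>)
qed

theorem mainTheorem5:
  fixes m c :: nat
    and P :: "('a, 'b) pre_digraph"
  assumes "m \<ge> 1" and "c \<ge> 1"
    and "complete_digraph (c * m + 1) P"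
  shows "minor_embeddable P (with_proj (hardware_graph m c))"
proof -
  define I where "I = {1..m} \<times> {1..c}"
  interpret P: graph P using assms(3) unfolding complete_digraph_def by (rule conjunct1)
  \<comment> \<open>The option type adds one index, \<open>None\<close>, to the \<open>c * m\<close>
    indices of the paths.\<close>
  define branch where "branch = case_option (comb m c) (bent_path m c)"
  have branch_simps: "branch None = comb m c" "branch (Some x) = bent_path m c x" for x
    by (simp_all add: branch_def)
  have "finite I" "card I = m * c" by (simp_all add: I_def)
  then have card: "card (verts P) = card (insert None (Some ` I))"
    using assms(3) by (simp add: complete_digraph_def card_image mult.commute)
  \<comment> \<open>Any bijection will do, since all pairs of branch sets touch.\<close>
  obtain f where f: "bij_betw f (verts P) (insert None (Some ` I))"
    using finite_same_card_bij[OF P.finite_verts _ card] \<open>finite I\<close> by auto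
  have fI: "f v \<in> insert None (Some ` I)" if "v \<in> verts P" for v
    using bij_betwE[OF f] that by blast
  have inj: "f u \<noteq> f v" if "u \<in> verts P" "v \<in> verts P" "u \<noteq> v" for u v
    using inj_onD[OF bij_betw_imp_inj_on[OF f]] that by blast
  have tree: "\<exists>T. subgraph T (with_proj (hardware_graph m c)) \<and> undirected_tree T \<and>
      verts T = branch s" if s: "s \<in> insert None (Some ` I)" for s
  proof (cases s)
    case None
    then show ?thesis using comb_tree[OF assms(1,2)] by (simp add: branch_simps)
  next
    case (Some x)
    then obtain i k where "x = (i, k)" "i \<in> {1..m}" "k \<in> {1..c}" using s by (auto simp: I_def)
    then show ?thesis using bent_path_tree[of i m k c] Some by (simp add: branch_simps)
  qed
  \<comment> \<open>Connectedness of the tree includes that its vertex set is nonempty.\<close>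
  have nonempty: "branch s \<noteq> {}" if "s \<in> insert None (Some ` I)" for s
    using tree[OF that] unfolding undirected_tree_def connected_def strongly_connected_def by auto
  have meet: "branch s \<inter> branch t = {} \<and> touching m c (branch s) (branch t)"
    if st: "s \<in> insert None (Some ` I)" "t \<in> insert None (Some ` I)" "s \<noteq> t" for s t
  proof -
    consider x y where "s = Some x" "t = Some y" "x \<in> I" "y \<in> I" "x \<noteq> y"
      | x where "s = Some x" "t = None" "x \<in> I"
      | y where "s = None" "t = Some y" "y \<in> I"
      using st by blast
    then show ?thesis
    proof cases
      case 1
      then show ?thesis
        using bent_paths_disjoint[of x m c y] bent_paths_touching[of x m c y]
        unfolding I_def by (simp only: branch_simps simp_thms)
    next
      case 2
      then show ?thesis
        using bent_path_comb_disjoint[of x m c] bent_path_comb_touching[of x m c]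
        unfolding I_def by (simp only: branch_simps simp_thms)
    next
      case 3
      then show ?thesis
        using bent_path_comb_disjoint[of y m c] touching_sym[OF bent_path_comb_touching[of y m c]]
        unfolding I_def by (simp only: branch_simps simp_thms Int_commute)
    qed
  qed
  have "minor_embedding P (with_proj (hardware_graph m c)) (branch \<circ> f)"
    unfolding minor_embedding_def
  proof (intro conjI ballI)
    show "disjoint_family_on (branch \<circ> f) (verts P)"
      using meet[OF fI fI inj] by (simp add: disjoint_family_on_def)
    fix uv assume "uv \<in> arcs_ends P"
    then obtain u v where "uv = (u, v)" "u \<in> verts P" "v \<in> verts P" "u \<noteq> v"
      using assms(3) by (auto simp: complete_digraph_def)
    then show "case uv of (u, v) \<Rightarrow> \<exists>i\<in>(branch \<circ> f) u. \<exists>j\<in>(branch \<circ> f) v.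
        (i, j) \<in> arcs_ends (with_proj (hardware_graph m c))"
      using meet[OF fI fI inj] by (simp add: touching_def)
  qed (use nonempty tree fI in auto)
  then show ?thesis by (auto simp: minor_embeddable_def)
qed

end
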